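(* Let $q>0$ be real with $q\ne1$. For every integer $n\ge1$ and every constant $a_0\ne0$, the $q$-difference equation $$x^2D_{q,x}^2y(x)+2(x+1)D_{q,x}y(x)-[n]_q\left([n-1]_q+2\right)y(x)=0$$ has a polynomial solution $y_{B,m_q}(x)=\sum_{\nu=0}^na_\nu x^\nu$ with (for those indices not exceeding $n$) $$a_1=\frac{[n]_q\left([n-1]_q+2\right)}{2}a_0,\qquad a_2=\frac{\left([n]_q\left([n-1]_q+2\right)-1\right)^2-1}{4[2]_q}a_0,$$ and, for every $\nu\ge3$, $$a_\nu=\frac{\left([n]_q\left([n-1]_q+2\right)-1\right)^2-1}{4[2]_q}a_0\prod_{j=2}^{\nu-1}\frac{[n]_q\left([n-1]_q+2\right)-[j]_q\left([j-1]_q+2\right)}{2[j+1]_q}.$$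
   Context: $[j]_q=\frac{1-q^j}{1-q}$ for integers $j\ge0$ (so $[0]_q=0$). $D_{q,x}$ is the Jackson $q$-derivative $D_{q,x}f(x)=\frac{f(qx)-f(x)}{qx-x}$, which acts on polynomials by $D_{q,x}1=0$, $D_{q,x}x^k=[k]_qx^{k-1}$ for $k\ge1$; $D_{q,x}^2=D_{q,x}\circ D_{q,x}$. *)

theory Defs
  imports "HOL-Analysis.Analysis"
begin

definition q_bracket :: "real \<Rightarrow> nat \<Rightarrow> real" where
  "q_bracket q j = (1 - q ^ j) / (1 - q)"

(* The difference quotient is undefined at 0; there the usual convention D f (0) = f'(0)
   is used, which is its limit for f differentiable at 0 and makes the monomial rule below
   hold at every point. *)
definition jackson_deriv :: "real \<Rightarrow> (real \<Rightarrow> real) \<Rightarrow> real \<Rightarrow> real" where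
  "jackson_deriv q f x = (if x = 0 then deriv f 0 else (f (q * x) - f x) / (q * x - x))"

lemma jackson_deriv_polynomial:
  assumes "q \<noteq> 1"
  shows "jackson_deriv q (\<lambda>x. \<Sum>k\<le>n. a k * x ^ k) =
    (\<lambda>x. \<Sum>k\<le>n. a k * (q_bracket q k * x ^ (k - 1)))"
proof
  fix x :: real
  show "jackson_deriv q (\<lambda>x. \<Sum>k\<le>n. a k * x ^ k) x =
    (\<Sum>k\<le>n. a k * (q_bracket q k * x ^ (k - 1)))"
  proof (cases "x = 0")
    case True
    have "((\<lambda>x. \<Sum>k\<le>n. a k * x ^ k) has_field_derivative
        (\<Sum>k\<le>n. a k * (real k * 0 ^ (k - 1)))) (at 0)"
      by (auto intro!: derivative_eq_intros sum.cong)
    then have "deriv (\<lambda>x. \<Sum>k\<le>n. a k * x ^ k) 0 = (\<Sum>k\<le>n. a k * (real k * 0 ^ (k - 1)))"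
      by (rule DERIV_imp_deriv)
    also have "\<dots> = (\<Sum>k\<le>n. a k * (q_bracket q k * 0 ^ (k - 1)))"
    proof (rule sum.cong)
      fix k
      show "a k * (real k * 0 ^ (k - 1)) = a k * (q_bracket q k * 0 ^ (k - 1))"
      proof (cases "k = 0 \<or> k = 1")
        case True
        then show ?thesis using assms by (auto simp: q_bracket_def)
      qed (simp add: power_0_left)
    qed simp
    finally show ?thesis using True by (simp add: jackson_deriv_def)
  next
    case False
    have "q * x - x \<noteq> 0" using False assms by (simp add: left_diff_distrib)
    have *: "a k * (q * x) ^ k - a k * x ^ k = a k * (q_bracket q k * x ^ (k - 1)) * (q * x - x)"
      for k
    proof (cases k)
      case (Suc m)
      have "q_bracket q k * (q - 1) = q ^ k - 1"
        using assms by (simp add: q_bracket_def field_simps)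
      then have "a k * (q * x) ^ k - a k * x ^ k = a k * (q_bracket q k * (q - 1)) * x ^ k"
        by (simp add: power_mult_distrib left_diff_distrib right_diff_distrib mult.assoc)
      also have "\<dots> = a k * (q_bracket q k * x ^ (k - 1)) * (q * x - x)"
        using Suc by (simp add: algebra_simps)
      finally show ?thesis .
    qed (simp add: q_bracket_def)
    have "(\<Sum>k\<le>n. a k * (q * x) ^ k) - (\<Sum>k\<le>n. a k * x ^ k) =
        (\<Sum>k\<le>n. a k * (q_bracket q k * x ^ (k - 1))) * (q * x - x)"
      unfolding sum_subtractf[symmetric] sum_distrib_right using * by simp
    then show ?thesis
      using False \<open>q * x - x \<noteq> 0\<close> by (simp add: jackson_deriv_def)
  qed
qed

lemma jackson_deriv_const: "jackson_deriv q (\<lambda>x. c) = (\<lambda>x. 0)"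
  by (simp add: jackson_deriv_def fun_eq_iff)

lemma jackson_deriv_power:
  assumes "q \<noteq> 1"
  shows "jackson_deriv q (\<lambda>x. x ^ k) = (\<lambda>x. q_bracket q k * x ^ (k - 1))"
proof -
  have [simp]: "(if i = k then 1 else 0) * z = (if i = k then z else 0)" for i and z :: real
    by simp
  show ?thesis
    using jackson_deriv_polynomial[OF assms, of "\<lambda>i. if i = k then 1 else 0" k] by simp
qed

end

theory Submission imports Defs begin

text \<open>
  Put \<open>\<lambda>\<^sub>k = [k]([k-1] + 2)\<close>. The operator \<open>x\<^sup>2D\<^sup>2 + 2(x+1)D\<close> sends \<open>x\<^sup>k\<close> to
  \<open>\<lambda>\<^sub>k x\<^sup>k + 2[k] x\<^sup>k\<^sup>-\<^sup>1\<close>, so the equation with eigenvalue \<open>\<lambda>\<^sub>n\<close> amounts to the two-term recurrence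
  \<open>2[k+1] a\<^sub>k\<^sub>+\<^sub>1 = (\<lambda>\<^sub>n - \<lambda>\<^sub>k) a\<^sub>k\<close>, whose solution vanishes beyond index \<open>n\<close>. The closed form
  for \<open>\<nu> \<ge> 2\<close> splits off the factors with \<open>j = 0, 1\<close>, which contribute
  \<open>L(L-2) = (L-1)\<^sup>2 - 1\<close> with \<open>L = \<lambda>\<^sub>n\<close>.
\<close>

lemma q_bracket_0 [simp]: "q_bracket q 0 = 0"
  by (simp add: q_bracket_def)

lemma q_bracket_1: "q \<noteq> 1 \<Longrightarrow> q_bracket q (Suc 0) = 1"
  by (simp add: q_bracket_def)

lemma q_bracket_nonzero:
  assumes "q > 0" "q \<noteq> 1" "k > 0"
  shows "q_bracket q k \<noteq> 0"
proof -
  have "q ^ k \<noteq> 1"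
    using assms power_eq_imp_eq_base[of q k 1] by auto
  then show ?thesis using assms(2) by (simp add: q_bracket_def)
qed

text \<open>Since \<open>q_bracket q 0 = 0\<close>, the constant term drops out; shifting the index
  puts the first derivative back into standard polynomial form, and the first-order rule applies
  again.\<close>

lemma jackson_deriv2_polynomial:
  assumes "q \<noteq> 1"
  shows "jackson_deriv q (jackson_deriv q (\<lambda>x. \<Sum>k\<le>n. a k * x ^ k)) =
    (\<lambda>x. \<Sum>k\<le>n. a k * (q_bracket q k * q_bracket q (k - 1) * x ^ (k - 2)))"
proof (cases n)
  case 0
  then show ?thesis by (simp add: jackson_deriv_const)
next
  case (Suc m)
  have "jackson_deriv q (\<lambda>x. \<Sum>k\<le>n. a k * x ^ k) =
      (\<lambda>x. \<Sum>k\<le>m. (a (Suc k) * q_bracket q (Suc k)) * x ^ k)"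
    unfolding jackson_deriv_polynomial[OF assms] Suc
    by (simp add: sum.atMost_Suc_shift mult.assoc del: sum.atMost_Suc)
  then have "jackson_deriv q (jackson_deriv q (\<lambda>x. \<Sum>k\<le>n. a k * x ^ k)) =
      (\<lambda>x. \<Sum>k\<le>m. a (Suc k) * q_bracket q (Suc k) * (q_bracket q k * x ^ (k - 1)))"
    by (simp only: jackson_deriv_polynomial[OF assms])
  then show ?thesis
    unfolding Suc
    by (simp add: sum.atMost_Suc_shift mult.assoc del: sum.atMost_Suc)
qed

text \<open>Under the recurrence, contributions of neighbouring coefficients cancel, so truncating
  at \<open>n\<close> leaves only a boundary term. It vanishes once \<open>L\<close> is the
  eigenvalue of index \<open>n\<close>.\<close>

lemma bessel_operator_polynomial:
  fixes L :: real
  assumes "q \<noteq> 1"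
    and rec: "\<And>k. 2 * q_bracket q (Suc k) * a (Suc k) =
      (L - q_bracket q k * (q_bracket q (k - 1) + 2)) * a k"
  shows "x ^ 2 * jackson_deriv q (jackson_deriv q (\<lambda>x. \<Sum>k\<le>n. a k * x ^ k)) x
      + 2 * (x + 1) * jackson_deriv q (\<lambda>x. \<Sum>k\<le>n. a k * x ^ k) x
      - L * (\<Sum>k\<le>n. a k * x ^ k)
    = (q_bracket q n * (q_bracket q (n - 1) + 2) - L) * a n * x ^ n" (is "?lhs = _")
proof -
  \<comment> \<open>\<open>T k\<close> is the degree-lowering part of the operator on the term
    \<open>a k * x ^ k\<close>; by \<open>rec\<close>, \<open>T (Suc k)\<close> is what the
    degree-preserving part lacks.\<close>
  define T where "T k = 2 * q_bracket q k * a k * x ^ (k - 1)" for k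
  have T_Suc: "T (Suc k) = (L - q_bracket q k * (q_bracket q (k - 1) + 2)) * a k * x ^ k" for k
    by (simp add: T_def rec)
  have "?lhs = (\<Sum>k\<le>n. x ^ 2 * (a k * (q_bracket q k * q_bracket q (k - 1) * x ^ (k - 2)))
      + 2 * (x + 1) * (a k * (q_bracket q k * x ^ (k - 1))) - L * (a k * x ^ k))"
    unfolding jackson_deriv2_polynomial[OF assms(1)]
    unfolding jackson_deriv_polynomial[OF assms(1)]
    by (simp only: sum_distrib_left sum.distrib sum_subtractf)
  also have "\<dots> = (\<Sum>k\<le>n. T k - T (Suc k))"
  proof (rule sum.cong)
    fix k
    \<comment> \<open>The exponents \<open>k - 1\<close> and \<open>k - 2\<close> truncate for small
      \<open>k\<close>, where the bracket factors vanish instead.\<close>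
    consider "k = 0" | "k = 1" | m where "k = Suc (Suc m)"
      by (metis One_nat_def not0_implies_Suc)
    then show "x ^ 2 * (a k * (q_bracket q k * q_bracket q (k - 1) * x ^ (k - 2)))
      + 2 * (x + 1) * (a k * (q_bracket q k * x ^ (k - 1))) - L * (a k * x ^ k) = T k - T (Suc k)"
      unfolding T_Suc unfolding T_def
      by cases (simp_all add: algebra_simps power2_eq_square)
  qed simp
  also have "\<dots> = - T (Suc n)"
    by (simp add: sum_telescope) (simp add: T_def)
  finally show ?thesis
    by (simp add: T_Suc algebra_simps)
qed

theorem corollary8:
  fixes q a0 :: real and n :: nat
  assumes "q > 0" and "q \<noteq> 1" and "n \<ge> 1" and "a0 \<noteq> 0"
  shows "\<exists>(a :: nat \<Rightarrow> real) (y :: real \<Rightarrow> real).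
    y = (\<lambda>x. \<Sum>\<nu>=0..n. a \<nu> * x ^ \<nu>) \<and>
    (\<forall>x. x ^ 2 * jackson_deriv q (jackson_deriv q y) x + 2 * (x + 1) * jackson_deriv q y x
        - q_bracket q n * (q_bracket q (n - 1) + 2) * y x = 0) \<and>
    a 0 = a0 \<and>
    a 1 = q_bracket q n * (q_bracket q (n - 1) + 2) / 2 * a0 \<and>
    (n \<ge> 2 \<longrightarrow>
      a 2 = ((q_bracket q n * (q_bracket q (n - 1) + 2) - 1) ^ 2 - 1) / (4 * q_bracket q 2) * a0) \<and>
    (\<forall>\<nu>\<ge>3.
      a \<nu> = ((q_bracket q n * (q_bracket q (n - 1) + 2) - 1) ^ 2 - 1) / (4 * q_bracket q 2) * a0 *
        (\<Prod>j=2..\<nu>-1. (q_bracket q n * (q_bracket q (n - 1) + 2)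
            - q_bracket q j * (q_bracket q (j - 1) + 2)) / (2 * q_bracket q (j + 1))))"
proof -
  define ev where "ev k = q_bracket q k * (q_bracket q (k - 1) + 2)" for k
  define r where "r j = (ev n - ev j) / (2 * q_bracket q (j + 1))" for j
  define a where "a \<nu> = a0 * (\<Prod>j<\<nu>. r j)" for \<nu>
  have ev: "ev 0 = 0" "ev (Suc 0) = 2"
    using assms(2) by (simp_all add: ev_def q_bracket_1)
  have rec: "2 * q_bracket q (Suc k) * a (Suc k) =
      (ev n - q_bracket q k * (q_bracket q (k - 1) + 2)) * a k" for k
    using q_bracket_nonzero[OF assms(1,2), of "Suc k"]
    by (simp add: a_def r_def ev_def)
  have a0: "a 0 = a0"
    by (simp add: a_def)
  have a1: "a 1 = ev n / 2 * a0"
    using assms(2) by (simp add: a_def r_def ev q_bracket_1)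
  have a2: "a 2 = ((ev n - 1) ^ 2 - 1) / (4 * q_bracket q 2) * a0"
    using assms(2) by (simp add: a_def r_def ev q_bracket_1 numeral_2_eq_2)
      (simp add: algebra_simps power2_eq_square)
  have a3: "a \<nu> = a 2 * (\<Prod>j=2..\<nu>-1. r j)" if "\<nu> \<ge> 3" for \<nu>
  proof -
    have "(\<Prod>j<\<nu>. r j) = (\<Prod>j<2. r j) * (\<Prod>j=2..<\<nu>. r j)"
      using prod.atLeastLessThan_concat[of 0 2 \<nu> r] that by (simp add: atLeast0LessThan)
    moreover have "{2..<\<nu>} = {2..\<nu>-1}"
      using that by auto
    ultimately show ?thesis by (simp only: a_def mult.assoc)
  qed
  have eq: "x ^ 2 * jackson_deriv q (jackson_deriv q (\<lambda>x. \<Sum>\<nu>=0..n. a \<nu> * x ^ \<nu>)) x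
      + 2 * (x + 1) * jackson_deriv q (\<lambda>x. \<Sum>\<nu>=0..n. a \<nu> * x ^ \<nu>) x
      - ev n * (\<Sum>\<nu>=0..n. a \<nu> * x ^ \<nu>) = 0" for x
    \<comment> \<open>With \<open>L = ev n\<close> the boundary term has the factor
      \<open>ev n - ev n\<close>.\<close>
    using bessel_operator_polynomial[OF assms(2) rec, of x n]
    by (simp only: atMost_atLeast0 flip: ev_def) simp
  show ?thesis
    \<comment> \<open>Folding \<open>a2\<close> turns the closed constant into \<open>a 2\<close>,
      so that its own equation becomes reflexive and the product formula becomes
      \<open>a3\<close>.\<close>
    unfolding ev_def[symmetric] r_def[symmetric] a2[symmetric]
    by (intro exI[of _ a] exI[of _ "\<lambda>x. \<Sum>\<nu>=0..n. a \<nu> * x ^ \<nu>"] conjI allI impI refl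
        eq a0 a1 a3)
qed

end
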